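(* Let $$\rho:=\frac{13-\sqrt{69}}{10}.$$ Then for every real $\varepsilon>0$ there exists a constant $C_\varepsilon>0$ such that $$g(n)\le C_\varepsilon\, n^{\rho+\varepsilon}$$ for all positive integers $n$, where $g(n)$ denotes the infimum of all real numbers $L\ge 0$ for which there exists a multiplicative Sidon set $A\subseteq\{1,2,\dots,n\}$ satisfying $A\cap[x,x+L]\neq\varnothing$ for every $x\in\mathbb{R}$ with $[x,x+L]\subseteq[1,n]$.
   Context: A set $A$ of positive integers is called a multiplicative Sidon set if all products $aa'$ with $a,a'\in A$ and $a\le a'$ are distinct; that is, if $a_1a_2=a_3a_4$ with $a_1,a_2,a_3,a_4\in A$, $a_1\le a_2$ and $a_3\le a_4$, then $a_1=a_3$ and $a_2=a_4$. In the definition of $g(n)$, $[x,x+L]$ and $[1,n]$ are closed intervals of real numbers. *)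

theory Defs
  imports Complex_Main
begin

definition mult_sidon :: "nat set \<Rightarrow> bool" where
  "mult_sidon A \<longleftrightarrow>
     (\<forall>a\<in>A. 0 < a) \<and>
     (\<forall>a1\<in>A. \<forall>a2\<in>A. \<forall>a3\<in>A. \<forall>a4\<in>A.
        a1 * a2 = a3 * a4 \<longrightarrow> a1 \<le> a2 \<longrightarrow> a3 \<le> a4 \<longrightarrow> a1 = a3 \<and> a2 = a4)"

definition sidon_gap_bounds :: "nat \<Rightarrow> real set" where
  "sidon_gap_bounds n =
     {L. 0 \<le> L \<and>
         (\<exists>A. A \<subseteq> {1..n} \<and> mult_sidon A \<and>
              (\<forall>x::real. {x..x + L} \<subseteq> {1..real n} \<longrightarrow> real ` A \<inter> {x..x + L} \<noteq> {}))}"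

text \<open>The set is bounded below by 0 and contains every L > n - 1 (no interval of length L fits,
  so the empty set A qualifies); hence the real infimum below is the genuine one.\<close>

definition sidon_gap :: "nat \<Rightarrow> real" where
  "sidon_gap n = Inf (sidon_gap_bounds n)"

definition sidon_rho :: real where
  "sidon_rho = (13 - sqrt 69) / 10"

end

theory Submission
  imports Defs "HOL-Analysis.Harmonic_Numbers" "HOL-Library.FuncSet" "HOL-Library.Disjoint_Sets"
    "HOL-Real_Asymp.Real_Asymp"
begin

text \<open>
  Cut \<open>{1..n}\<close> into consecutive blocks of length \<open>L\<close> and pick one element from each block.
  The resulting set meets every interval of length \<open>2 * L\<close>, so it is enough to pick it
  multiplicatively Sidon, that is, without four distinct elements satisfying \<open>a * b = c * d\<close> and
  without three distinct elements satisfying \<open>a * b = c * c\<close>.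

  Such a choice exists by a counting argument in the style of Rosenfeld, which replaces the local
  lemma: by induction, adding one more block multiplies the number of good choices by at least
  \<open>\<beta> = L / 2\<close>. Indeed, an obstruction \<open>e\<close> through the new block spoils at most a fraction
  \<open>\<beta> powr (1 - card e)\<close> of the good choices on the old blocks, because removing the
  \<open>card e - 1\<close> blocks meeting \<open>e\<close> costs a factor \<open>\<beta>\<close> each. Up to logarithms,
  a block has \<open>L + sqrt n\<close> factorisations of its elements and hence meets at most
  \<open>(L + sqrt n) * n\<close> quadruples and \<open>(L + sqrt n) * sqrt n\<close> triples, so that
  \<open>L = n powr (2/5)\<close> suffices (any exponent above \<open>3/8\<close> would do). Finally,
  \<open>2/5 < sidon_rho\<close>.
\<close>

section \<open>Counting transversals that avoid a family of obstructions\<close>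

definition good_choices :: "('i \<Rightarrow> 'a set) \<Rightarrow> 'a set set \<Rightarrow> 'i set \<Rightarrow> ('i \<Rightarrow> 'a) set" where
  "good_choices I B S = {f \<in> PiE S I. \<forall>e\<in>B. \<not> e \<subseteq> f ` S}"

lemma finite_good_choices:
  assumes "finite S" "\<And>i. i \<in> S \<Longrightarrow> finite (I i)"
  shows "finite (good_choices I B S)"
  unfolding good_choices_def using finite_PiE[of S I] assms by simp

lemma restrict_good_choices:
  assumes "f \<in> good_choices I B S" "T \<subseteq> S"
  shows "restrict f T \<in> good_choices I B T"
proof -
  have f: "f \<in> PiE S I" "\<And>e. e \<in> B \<Longrightarrow> \<not> e \<subseteq> f ` S"
    using assms(1) unfolding good_choices_def by auto
  have "restrict f T \<in> PiE T I" using f(1) assms(2) by (auto simp: PiE_iff)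
  moreover have "restrict f T ` T \<subseteq> f ` S" using assms(2) by auto
  ultimately show ?thesis using f(2) unfolding good_choices_def by blast
qed

text \<open>The blocks are disjoint, so each element of \<open>V\<close> can only be chosen in its
  own block. All choices whose image contains \<open>V\<close> therefore agree on the
  \<open>card V\<close> indices concerned and are determined by their restriction to the other
  indices, which is again good. Restoring these indices one by one gains a factor
  \<open>\<beta>\<close> each. Growth is assumed from proper subsets of \<open>S\<close> only, so
  that the lemma can be applied inside the induction that proves growth.\<close>

lemma good_choices_containing:
  fixes \<beta> :: real
  assumes fin: "finite S" "\<And>i. i \<in> S \<Longrightarrow> finite (I i)"
    and disj: "disjoint_family_on I S"
    and \<beta>: "\<beta> > 0"
    and growth: "\<And>T j. T \<subset> S \<Longrightarrow> j \<in> S - T \<Longrightarrow>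
      \<beta> * card (good_choices I B T) \<le> card (good_choices I B (insert j T))"
  shows "card {f \<in> good_choices I B S. V \<subseteq> f ` S} * \<beta> ^ card V \<le> card (good_choices I B S)"
    (is "real (card ?X) * _ \<le> _")
proof (cases "?X = {}")
  case False
  then obtain f0 where f0: "f0 \<in> good_choices I B S" "V \<subseteq> f0 ` S" by auto
  \<comment> \<open>Taking one index per element of \<open>V\<close> gives
    \<open>card R = card V\<close>. \<open>R\<close> is read off from \<open>f0\<close>, but
    \<open>fixed\<close> shows that every member of the set takes the same values on it.\<close>
  obtain R where R: "R \<subseteq> S" "inj_on f0 R" "V = f0 ` R"
    using f0(2) by (meson subset_image_inj)
  have finR: "finite R" using R fin finite_subset by blast
  have fixed: "f r = f0 r" if f: "f \<in> ?X" and r: "r \<in> R" for f r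
  proof -
    have "f0 r \<in> f ` S" using f r R(3) by blast
    then obtain r' where r': "r' \<in> S" "f0 r = f r'" by blast
    have "r \<in> S" using r R(1) by blast
    moreover have "f0 \<in> PiE S I" "f \<in> PiE S I"
      using f0 f unfolding good_choices_def by auto
    ultimately have "f0 r \<in> I r" "f r' \<in> I r'" using r'(1) by (meson PiE_mem)+
    then have "I r \<inter> I r' \<noteq> {}" using r'(2) by auto
    then have "r = r'" using disjoint_family_onD[OF disj \<open>r \<in> S\<close> r'(1)] by blast
    then show ?thesis using r' by simp
  qed
  have "inj_on (\<lambda>f. restrict f (S - R)) ?X"
  proof (rule inj_onI)
    fix f g assume fg: "f \<in> ?X" "g \<in> ?X" "restrict f (S - R) = restrict g (S - R)"
    have ext: "f \<in> extensional S" "g \<in> extensional S"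
      using fg unfolding good_choices_def by (auto simp: PiE_iff)
    show "f = g"
    proof (rule extensionalityI[OF ext])
      fix i assume "i \<in> S"
      then show "f i = g i"
        using fixed[OF fg(1)] fixed[OF fg(2)] fun_cong[OF fg(3), of i] by (cases "i \<in> R") auto
    qed
  qed
  moreover have "(\<lambda>f. restrict f (S - R)) ` ?X \<subseteq> good_choices I B (S - R)"
    using restrict_good_choices by fastforce
  ultimately have "card ?X \<le> card (good_choices I B (S - R))"
    using card_inj_on_le finite_good_choices fin by (metis (no_types, lifting) DiffD1 finite_Diff)
  then have "card ?X * \<beta> ^ card V \<le> card (good_choices I B (S - R)) * \<beta> ^ card R"
    using \<beta> R by (simp add: card_image)
  also have "\<dots> \<le> card (good_choices I B (S - R \<union> R))"
    using finR R(1)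
  proof (induction R rule: finite_induct)
    case empty
    then show ?case by simp
  next
    case (insert r R)
    let ?g = "\<lambda>T. real (card (good_choices I B T))"
    have "?g (S - insert r R) * \<beta> ^ card (insert r R) = (\<beta> * ?g (S - insert r R)) * \<beta> ^ card R"
      using insert by simp
    also have "\<dots> \<le> ?g (insert r (S - insert r R)) * \<beta> ^ card R"
      using \<beta> insert.prems by (intro mult_right_mono growth) auto
    also have "insert r (S - insert r R) = S - R" using insert by auto
    also have "?g (S - R) * \<beta> ^ card R \<le> ?g (S - R \<union> R)" using insert by simp
    also have "S - R \<union> R = S - insert r R \<union> insert r R" using insert by auto
    finally show ?case .
  qed
  also have "S - R \<union> R = S" using R by auto
  finally show ?thesis .
next
  case True
  show ?thesis unfolding True by simp
qed

text \<open>Induction on \<open>card S\<close>. Among the \<open>card (I j)\<close> one-point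
  extensions of each good choice, the failing ones are counted by the obstruction they complete. By
  the previous lemma an obstruction \<open>e\<close> accounts for at most a fraction
  \<open>1 / \<beta> ^ (card e - 1)\<close> of the choices on \<open>S\<close>. The weight condition
  bounds the total loss by \<open>card (I j) - \<beta>\<close> per choice, so \<open>\<beta>\<close>
  extensions survive on average.\<close>

lemma good_choices_growth:
  fixes \<beta> :: real and I :: "'i \<Rightarrow> 'a set"
  assumes finJ: "finite J" and fin: "\<And>i. i \<in> J \<Longrightarrow> finite (I i)"
    and disj: "disjoint_family_on I J"
    and \<beta>: "\<beta> > 0"
    and finB: "finite B" "\<And>e. e \<in> B \<Longrightarrow> finite e"
    and weight: "\<And>i. i \<in> J \<Longrightarrow>
      (\<Sum>e | e \<in> B \<and> e \<inter> I i \<noteq> {}. 1 / \<beta> ^ (card e - 1)) \<le> card (I i) - \<beta>"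
    and "S \<subseteq> J" "j \<in> J - S"
  shows "\<beta> * card (good_choices I B S) \<le> card (good_choices I B (insert j S))"
  using \<open>S \<subseteq> J\<close> \<open>j \<in> J - S\<close>
proof (induction "card S" arbitrary: S j rule: less_induct)
  case less
  have finS: "finite S" using less.prems finJ finite_subset by auto
  let ?G = "good_choices I B"
  have j: "j \<in> J" "j \<notin> S" using less.prems by auto
  have disjS: "disjoint_family_on I S"
    using disj less.prems disjoint_family_on_mono by blast
  have finI: "\<And>i. i \<in> S \<Longrightarrow> finite (I i)" using fin less.prems by auto
  have finG: "finite (?G S)" using finS finI by (intro finite_good_choices)
  have finG': "finite (?G (insert j S))"
    using finS fin less.prems by (intro finite_good_choices) auto
  define Bj where "Bj = {e \<in> B. e \<inter> I j \<noteq> {}}"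
  define N where "N e = {f \<in> ?G S. e - I j \<subseteq> f ` S}" for e
  \<comment> \<open>A choice on \<open>S\<close> has no values in \<open>I j\<close>, so an
    obstruction completed by a new value \<open>x\<close> meets \<open>I j\<close> exactly in
    \<open>x\<close>. Obstructions with two or more points in the block are never completed. For
    \<open>e\<close> in \<open>X\<close> the value \<open>x\<close> is determined by
    \<open>e\<close>, so the bad pairs due to \<open>e\<close> number just
    \<open>card (N e)\<close>.\<close>
  define X where "X = {e \<in> Bj. card (e \<inter> I j) = 1}"
  have finX: "finite X" unfolding X_def Bj_def using finB by simp
  define ext where "ext = (\<lambda>(f, x). (f :: 'i \<Rightarrow> 'a)(j := x))"
  have outside: "f ` S \<inter> I j = {}" if "f \<in> ?G S" for f
  proof -
    have "I i \<inter> I j = {}" if "i \<in> S" for i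
      using disjoint_family_onD[OF disj] that less.prems by blast
    moreover have "\<forall>i\<in>S. f i \<in> I i" using that unfolding good_choices_def by auto
    ultimately show ?thesis by blast
  qed
  have bad: "?G S \<times> I j \<subseteq> {p \<in> ?G S \<times> I j. ext p \<in> ?G (insert j S)} \<union>
      (\<Union>e\<in>X. N e \<times> (e \<inter> I j))"
  proof
    fix p assume "p \<in> ?G S \<times> I j"
    then obtain f x where p: "p = (f, x)" and f: "f \<in> ?G S" and x: "x \<in> I j" by auto
    show "p \<in> {p \<in> ?G S \<times> I j. ext p \<in> ?G (insert j S)} \<union> (\<Union>e\<in>X. N e \<times> (e \<inter> I j))"
    proof (cases "ext p \<in> ?G (insert j S)")
      case True
      then show ?thesis using p f x by auto
    next
      case False
      have fS: "f(j := x) ` insert j S = insert x (f ` S)" using j by auto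
      have "f(j := x) \<in> PiE (insert j S) I"
        using f x j unfolding good_choices_def by (auto simp: PiE_iff extensional_def)
      then obtain e where e: "e \<in> B" "e \<subseteq> insert x (f ` S)"
        using False unfolding p ext_def prod.case good_choices_def mem_Collect_eq fS by blast
      have "\<not> e \<subseteq> f ` S" using f e unfolding good_choices_def by auto
      then have ex: "e \<inter> I j = {x}" using e outside[OF f] x by auto
      then have "e \<in> X" using e unfolding X_def Bj_def by auto
      moreover have "f \<in> N e" using e f x unfolding N_def by auto
      ultimately show ?thesis using ex p by auto
    qed
  qed
  have Nle: "real (card (N e)) \<le> card (?G S) / \<beta> ^ (card e - 1)" if "e \<in> X" for e
  proof -
    have "finite e" using that finB unfolding X_def Bj_def by auto
    then have "card (e - I j) = card e - 1"
      using that unfolding X_def by (simp add: card_Diff_subset_Int)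
    moreover have "card (N e) * \<beta> ^ card (e - I j) \<le> card (?G S)"
      unfolding N_def
    proof (rule good_choices_containing[OF finS finI disjS \<beta>])
      fix T i assume T: "T \<subset> S" "i \<in> S - T"
      show "\<beta> * card (?G T) \<le> card (?G (insert i T))"
        using less.hyps[of T i] psubset_card_mono[OF finS T(1)] T less.prems by auto
    qed
    ultimately show ?thesis using \<beta> by (simp add: field_simps)
  qed
  \<comment> \<open>Functions in \<open>PiE S I\<close> are \<open>undefined\<close> at
    \<open>j\<close>, so both \<open>x\<close> and \<open>f\<close> can be recovered from
    \<open>f(j := x)\<close>.\<close>
  have "inj_on ext (?G S \<times> I j)"
  proof (rule inj_onI, clarify)
    fix f x f' x'
    assume *: "f \<in> ?G S" "f' \<in> ?G S" "ext (f, x) = ext (f', x')"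
    have "f j = undefined" "f' j = undefined"
      using * j unfolding good_choices_def by (auto simp: PiE_iff extensional_def)
    then show "f = f' \<and> x = x'"
      using *(3) unfolding ext_def by (metis case_prod_conv fun_upd_same fun_upd_triv fun_upd_upd)
  qed
  then have new: "card {p \<in> ?G S \<times> I j. ext p \<in> ?G (insert j S)} \<le> card (?G (insert j S))"
    by (intro card_inj_on_le[where f = ext] finG') (auto intro: inj_on_subset)
  have fing: "finite {p \<in> ?G S \<times> I j. ext p \<in> ?G (insert j S)}"
    using finG fin j by auto
  have finU: "finite (\<Union>e\<in>X. N e \<times> (e \<inter> I j))"
    using finX finG fin j unfolding N_def by auto
  have "card (?G S) * card (I j) = card (?G S \<times> I j)" by (simp add: card_cartesian_product)
  also have "\<dots> \<le> card ({p \<in> ?G S \<times> I j. ext p \<in> ?G (insert j S)} \<union>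
      (\<Union>e\<in>X. N e \<times> (e \<inter> I j)))"
    using bad fing finU by (intro card_mono) auto
  also have "\<dots> \<le> card (?G (insert j S)) + (\<Sum>e\<in>X. card (N e \<times> (e \<inter> I j)))"
    by (rule order_trans[OF card_Un_le add_mono[OF new card_UN_le[OF finX]]])
  also have "(\<Sum>e\<in>X. card (N e \<times> (e \<inter> I j))) = (\<Sum>e\<in>X. card (N e))"
    by (intro sum.cong) (auto simp: X_def card_cartesian_product)
  finally have "real (card (?G S) * card (I j)) \<le> real (card (?G (insert j S)) + (\<Sum>e\<in>X. card (N e)))"
    by (subst of_nat_le_iff)
  also have "\<dots> = card (?G (insert j S)) + (\<Sum>e\<in>X. real (card (N e)))" by simp
  also have "(\<Sum>e\<in>X. real (card (N e))) \<le> (\<Sum>e\<in>X. card (?G S) / \<beta> ^ (card e - 1))"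
    by (intro sum_mono Nle)
  also have "\<dots> \<le> (\<Sum>e\<in>Bj. card (?G S) / \<beta> ^ (card e - 1))"
    using finB \<beta> by (intro sum_mono2) (auto simp: X_def Bj_def)
  also have "\<dots> = card (?G S) * (\<Sum>e\<in>Bj. 1 / \<beta> ^ (card e - 1))"
    by (simp add: sum_distrib_left)
  also have "\<dots> \<le> card (?G S) * (card (I j) - \<beta>)"
    using weight[OF j(1)] unfolding Bj_def by (intro mult_left_mono) auto
  finally show ?case by (simp add: algebra_simps)
qed

theorem exists_transversal_avoiding:
  fixes \<beta> :: real
  assumes "finite J" and "\<And>i. i \<in> J \<Longrightarrow> finite (I i)"
    and "disjoint_family_on I J"
    and "\<beta> > 0"
    and "finite B" "\<And>e. e \<in> B \<Longrightarrow> finite e" "{} \<notin> B"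
    and "\<And>i. i \<in> J \<Longrightarrow>
      (\<Sum>e | e \<in> B \<and> e \<inter> I i \<noteq> {}. 1 / \<beta> ^ (card e - 1)) \<le> card (I i) - \<beta>"
  shows "\<exists>f\<in>PiE J I. \<forall>e\<in>B. \<not> e \<subseteq> f ` J"
proof -
  have "card (good_choices I B S) > 0" if "S \<subseteq> J" for S
    using finite_subset[OF that assms(1)] that
  proof (induction S rule: finite_induct)
    case empty
    \<comment> \<open>The empty choice is good because the empty set is not an obstruction, so the
      count starts at 1.\<close>
    have "good_choices I B {} = {\<lambda>_. undefined}"
      using assms(7) unfolding good_choices_def by auto
    then show ?case by simp
  next
    case (insert j S)
    then have "0 < \<beta> * card (good_choices I B S)" using assms(4) by simp
    also have "\<dots> \<le> card (good_choices I B (insert j S))"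
      using insert by (intro good_choices_growth[of J]) (use assms in auto)
    finally show ?case by simp
  qed
  from this[of J] have "good_choices I B J \<noteq> {}" by force
  then show ?thesis unfolding good_choices_def by blast
qed

section \<open>Obstructions to the multiplicative Sidon property\<close>

definition quad_obstructions :: "nat \<Rightarrow> nat set set" where
  "quad_obstructions n = {e. e \<subseteq> {1..n} \<and> card e = 4 \<and> (\<exists>a b c d. e = {a, b, c, d} \<and> a * b = c * d)}"

definition triple_obstructions :: "nat \<Rightarrow> nat set set" where
  "triple_obstructions n = {e. e \<subseteq> {1..n} \<and> card e = 3 \<and> (\<exists>a b c. e = {a, b, c} \<and> a * b = c * c)}"

text \<open>If the two sides share a factor, cancellation and the ordering make the solution
  trivial; if both sides are squares, their roots agree. In every other case the solution has four
  distinct entries, or three when exactly one side is a square. The cardinality conditions in the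
  two kinds of obstruction encode this distinctness.\<close>

lemma mult_sidonI:
  assumes A: "A \<subseteq> {1..n}"
    and avoid: "\<And>e. e \<in> quad_obstructions n \<union> triple_obstructions n \<Longrightarrow> \<not> e \<subseteq> A"
  shows "mult_sidon A"
proof -
  have quad: False if "a \<in> A" "b \<in> A" "c \<in> A" "d \<in> A" "a * b = c * d" "distinct [a, b, c, d]"
    for a b c d
  proof -
    have "{a, b, c, d} \<in> quad_obstructions n"
      using that A unfolding quad_obstructions_def by auto
    then show False using avoid[of "{a, b, c, d}"] that by auto
  qed
  have triple: False if "a \<in> A" "b \<in> A" "c \<in> A" "a * b = c * c" "distinct [a, b, c]" for a b c
  proof -
    have "{a, b, c} \<in> triple_obstructions n"
      using that A unfolding triple_obstructions_def by auto
    then show False using avoid[of "{a, b, c}"] that by auto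
  qed
  have pos: "\<And>a. a \<in> A \<Longrightarrow> 0 < a" using A by force
  have "a = c \<and> b = d"
    if *: "a \<in> A" "b \<in> A" "c \<in> A" "d \<in> A" "a * b = c * d" "a \<le> b" "c \<le> d" for a b c d
  proof -
    have pos': "a > 0" "b > 0" "c > 0" "d > 0" using * pos by auto
    have ac: "a = c \<longleftrightarrow> b = d" and ad: "a = d \<longleftrightarrow> b = c" using * pos' by auto
    show ?thesis
    proof (cases "a = c \<or> a = d")
      case True
      then show ?thesis using ac ad * by auto
    next
      case False
      consider "a = b" "c = d" | "a = b" "c \<noteq> d" | "a \<noteq> b" "c = d" | "a \<noteq> b" "c \<noteq> d" by auto
      then show ?thesis
      proof cases
        case 1
        then have "a ^ 2 = c ^ 2" using * by (simp add: power2_eq_square)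
        then show ?thesis using False by simp
      next
        case 2
        then show ?thesis using triple[of c d a] * False by auto
      next
        case 3
        then show ?thesis using triple[of a b c] * False ac ad by auto
      next
        case 4
        then show ?thesis using quad[of a b c d] * False ac ad by auto
      qed
    qed
  qed
  then show ?thesis unfolding mult_sidon_def using pos by blast
qed

section \<open>Counting the obstructions that meet a short interval\<close>

definition factor_pairs :: "nat set \<Rightarrow> (nat \<times> nat) set" where
  "factor_pairs M = {(g, a). g * a \<in> M}"

lemma card_multiples_in_interval:
  fixes g u L :: nat
  assumes "g > 0"
  shows "finite {a. g * a \<in> {u+1..u+L}}" "card {a. g * a \<in> {u+1..u+L}} \<le> L / g + 1"
proof -
  have eq: "{a. g * a \<in> {u+1..u+L}} = {u div g + 1..(u + L) div g}"
    using assms by (auto simp: less_eq_div_iff_mult_less_eq Suc_le_eq div_less_iff_less_mult mult.commute)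
  show "finite {a. g * a \<in> {u+1..u+L}}" unfolding eq by simp
  have "u mod g + L mod g < 2 * g"
    using mod_less_divisor[OF assms, of u] mod_less_divisor[OF assms, of L] by linarith
  then have "(u mod g + L mod g) div g < 2" using assms by (simp add: div_less_iff_less_mult)
  then have "(u + L) div g \<le> u div g + L div g + 1" using div_add1_eq[of u L g] by linarith
  then have "card {a. g * a \<in> {u+1..u+L}} \<le> L div g + 1" unfolding eq by simp
  also have "real (L div g + 1) \<le> L / g + 1" by (simp add: of_nat_div_le_of_nat)
  finally show "card {a. g * a \<in> {u+1..u+L}} \<le> L / g + 1" by simp
qed

text \<open>One of the two factors is at most \<open>s\<close>, the stand-in for the square root of
  \<open>n\<close>. Fixing it as \<open>g\<close> leaves at most \<open>L / g + 1\<close> cofactors;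
  summing over \<open>g\<close> gives the bound, with the factor 2 for the order of the pair. The
  summand \<open>s\<close> comes from the rounding terms \<open>+ 1\<close>.\<close>

lemma card_factor_pairs:
  assumes n: "u + L \<le> n" and s: "n < (s + 1) ^ 2"
  shows "finite (factor_pairs {u+1..u+L})"
    and "card (factor_pairs {u+1..u+L}) \<le> 2 * (L * harm s + s)"
proof -
  let ?M = "{u+1..u+L}"
  define T where "T = Sigma {1..s} (\<lambda>g. {a. g * a \<in> ?M})"
  have finT: "finite T" unfolding T_def using card_multiples_in_interval by (intro finite_SigmaI) auto
  have sub: "factor_pairs ?M \<subseteq> T \<union> prod.swap ` T"
  proof (clarify, goal_cases)
    case (1 g a)
    then have ga: "g * a \<in> ?M" unfolding factor_pairs_def by simp
    have "g \<le> s \<or> a \<le> s"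
    proof (rule ccontr)
      assume "\<not> (g \<le> s \<or> a \<le> s)"
      then have "(s + 1) * (s + 1) \<le> g * a" by (intro mult_le_mono) auto
      then show False using ga n s by (simp add: power2_eq_square)
    qed
    moreover have "g \<ge> 1" "a \<ge> 1" using ga by (auto simp: Suc_le_eq intro!: Nat.gr0I)
    ultimately have "(g, a) \<in> T \<or> (a, g) \<in> T" using ga unfolding T_def by (auto simp: mult.commute)
    then show ?case using 1 by force
  qed
  show "finite (factor_pairs ?M)" using sub finT finite_subset by blast
  have "card (factor_pairs ?M) \<le> card (T \<union> prod.swap ` T)" using sub finT by (intro card_mono) auto
  also have "\<dots> \<le> card T + card T"
    using card_Un_le[of T "prod.swap ` T"] card_image_le[OF finT, of prod.swap] by linarith
  finally have "card (factor_pairs ?M) \<le> 2 * real (card T)" by simp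
  also have "real (card T) = (\<Sum>g=1..s. real (card {a. g * a \<in> ?M}))"
    unfolding T_def using card_multiples_in_interval by (subst card_SigmaI) auto
  also have "\<dots> \<le> (\<Sum>g=1..s. L / g + 1)"
    using card_multiples_in_interval by (intro sum_mono) auto
  also have "\<dots> = L * harm s + s"
    unfolding harm_def by (simp add: sum.distrib sum_distrib_left divide_inverse)
  finally show "card (factor_pairs ?M) \<le> 2 * (L * harm s + s)" by simp
qed

lemma card_pairs_prod_le:
  "finite {(x, y). 1 \<le> x \<and> 1 \<le> y \<and> x * y \<le> (n::nat)}"
  "card {(x, y). 1 \<le> x \<and> 1 \<le> y \<and> x * y \<le> n} \<le> n * (harm n :: real)"
proof -
  have eq: "{(x, y). 1 \<le> x \<and> 1 \<le> y \<and> x * y \<le> n} = Sigma {1..n} (\<lambda>x. {1..n div x})"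
  proof (auto simp: less_eq_div_iff_mult_less_eq mult.commute)
    fix x y :: nat assume "Suc 0 \<le> x" "Suc 0 \<le> y" "x * y \<le> n"
    then show "x \<le> n" using mult_le_mono2[of 1 y x] by linarith
  qed
  show "finite {(x, y). 1 \<le> x \<and> 1 \<le> y \<and> x * y \<le> n}" unfolding eq by auto
  have "real (card (Sigma {1..n} (\<lambda>x. {1..n div x}))) = (\<Sum>x=1..n. real (n div x))"
    by (subst card_SigmaI) auto
  also have "\<dots> \<le> (\<Sum>x=1..n. n / x)" by (intro sum_mono of_nat_div_le_of_nat)
  also have "\<dots> = n * harm n" unfolding harm_def by (simp add: sum_distrib_left divide_inverse)
  finally show "card {(x, y). 1 \<le> x \<and> 1 \<le> y \<and> x * y \<le> n} \<le> n * (harm n :: real)" unfolding eq .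
qed

text \<open>Take \<open>g\<close> to be the gcd of \<open>a\<close> and \<open>c\<close>; the
  coprime cofactors \<open>h\<close> and \<open>p\<close> satisfy \<open>h * b = p * d\<close>, so
  \<open>p\<close> divides \<open>b\<close>. Coprimality is kept in the conclusion for the case
  \<open>c = d\<close>.\<close>

lemma four_number_theorem:
  fixes a b c d :: nat
  assumes "a * b = c * d" "a > 0"
  obtains g h p q where "a = g * h" "b = p * q" "c = g * p" "d = h * q" "coprime h p"
proof -
  define g where "g = gcd a c"
  have g: "g > 0" using assms unfolding g_def by simp
  obtain h p where hp: "a = g * h" "c = g * p" "coprime h p"
    using gcd_coprime_exists[of a c] assms unfolding g_def by (metis gcd_eq_0_iff mult.commute not_gr0)
  have hb: "h * b = p * d" using assms g hp by (simp add: mult.assoc)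
  then have "p dvd b" using hp(3) by (metis coprime_commute coprime_dvd_mult_right_iff dvd_triv_left)
  then obtain q where q: "b = p * q" by blast
  show thesis
  proof (cases "p = 0")
    \<comment> \<open>Here \<open>c = b = 0\<close>, and \<open>q\<close> is not determined by
      \<open>b = p * q\<close>. Coprimality to 0 forces \<open>h = 1\<close>, so the witness
      \<open>q = d\<close> works.\<close>
    case True
    then have "h = 1" using hp by simp
    then show thesis using that[of g 1 0 d] hp q True by simp
  next
    case False
    then have "d = h * q" using hb q by simp
    then show thesis using that hp q by blast
  qed
qed

text \<open>The equation is symmetric under swapping factors and sides, so the element
  \<open>x\<close> in \<open>M\<close> may be taken as the first factor. The quadruple is then
  determined by a factorisation of \<open>x\<close> and a factorisation of the number multiplied
  with \<open>x\<close>.\<close>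

lemma quad_obstructions_meeting:
  "{e \<in> quad_obstructions n. e \<inter> M \<noteq> {}} \<subseteq>
     (\<lambda>((g, h), (p, q)). {g * h, p * q, g * p, h * q}) `
       (factor_pairs M \<times> {(x, y). 1 \<le> x \<and> 1 \<le> y \<and> x * y \<le> n})"
proof
  fix e assume "e \<in> {e \<in> quad_obstructions n. e \<inter> M \<noteq> {}}"
  then obtain x a b c d where e: "x \<in> e" "x \<in> M" "e \<subseteq> {1..n}" "e = {a, b, c, d}" "a * b = c * d"
    unfolding quad_obstructions_def by blast
  have "\<exists>b c d. e = {x, b, c, d} \<and> x * b = c * d"
  proof -
    consider "x = a" | "x = b" | "x = c" | "x = d" using e by auto
    then show ?thesis
    proof cases
      case 1
      then show ?thesis using e by blast
    next
      case 2
      then show ?thesis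
        using e by (intro exI[of _ a] exI[of _ c] exI[of _ d]) (auto simp: mult.commute)
    next
      case 3
      then show ?thesis
        using e by (intro exI[of _ d] exI[of _ a] exI[of _ b]) (auto simp: mult.commute)
    next
      case 4
      then show ?thesis
        using e by (intro exI[of _ c] exI[of _ a] exI[of _ b]) (auto simp: mult.commute)
    qed
  qed
  then obtain b c d where e': "e = {x, b, c, d}" "x * b = c * d" by blast
  have "x \<in> {1..n}" "b \<in> {1..n}" using e(3) e'(1) by blast+
  then have pos: "x > 0" "1 \<le> b" "b \<le> n" by auto
  obtain g h p q where *: "x = g * h" "b = p * q" "c = g * p" "d = h * q"
    using four_number_theorem[OF e'(2) pos(1)] by metis
  show "e \<in> (\<lambda>((g, h), (p, q)). {g * h, p * q, g * p, h * q}) `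
       (factor_pairs M \<times> {(x, y). 1 \<le> x \<and> 1 \<le> y \<and> x * y \<le> n})"
  proof (rule image_eqI)
    show "e = (\<lambda>((g, h), (p, q)). {g * h, p * q, g * p, h * q}) ((g, h), (p, q))"
      using e'(1) * by simp
    have "1 \<le> p" "1 \<le> q" using pos(2) *(2) by (auto simp: Suc_le_eq intro!: Nat.gr0I)
    then show "((g, h), (p, q)) \<in> factor_pairs M \<times> {(x, y). 1 \<le> x \<and> 1 \<le> y \<and> x * y \<le> n}"
      using e(2) *(1,2) pos(3) by (simp add: factor_pairs_def)
  qed
qed

text \<open>The four-number factorisation with \<open>c = d\<close> gives
  \<open>g * p = h * q\<close> with \<open>h\<close> coprime to \<open>p\<close>; hence
  \<open>g = h * k\<close> and \<open>q = k * p\<close>.\<close>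

lemma prod_eq_square:
  fixes a b c :: nat
  assumes "a * b = c * c" "a > 0"
  obtains k p q where "a = k * p * p" "b = k * q * q" "c = k * p * q"
proof -
  obtain g h p q where *: "a = g * h" "b = p * q" "c = g * p" "c = h * q" "coprime h p"
    using four_number_theorem[OF assms] by metis
  have h: "h > 0" using assms * by auto
  have "h dvd g" using * by (metis coprime_dvd_mult_left_iff dvd_triv_left)
  then obtain k where k: "g = h * k" by blast
  then have "q = k * p" using * h by (simp add: mult.assoc)
  then show thesis using that[of k h p] * k by (simp add: mult_ac)
qed

text \<open>A triple has the form \<open>k * p * p\<close>, \<open>k * q * q\<close>,
  \<open>k * p * q\<close> with \<open>p\<close> and \<open>q\<close> at most \<open>s\<close>. A
  factorisation of its member in \<open>M\<close> together with one of \<open>p\<close>,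
  \<open>q\<close> recovers it: from \<open>(k * p, p)\<close> and \<open>q\<close> by the first map
  (and likewise with \<open>p\<close> and \<open>q\<close> exchanged), or from
  \<open>(k * p, q)\<close> and \<open>p\<close> by the second, for the middle term.\<close>

lemma triple_obstructions_meeting:
  assumes s: "n < (s + 1) ^ 2"
  shows "{e \<in> triple_obstructions n. e \<inter> M \<noteq> {}} \<subseteq>
     (\<lambda>((g, h), p). {g * h, (g div h) * p * p, g * p}) ` (factor_pairs M \<times> {1..s}) \<union>
     (\<lambda>((g, h), p). {g * h, g * p, (g div p) * h * h}) ` (factor_pairs M \<times> {1..s})"
    (is "_ \<subseteq> ?f ` _ \<union> ?g ` _")
proof
  fix e assume "e \<in> {e \<in> triple_obstructions n. e \<inter> M \<noteq> {}}"
  then obtain x a b c where e: "x \<in> e" "x \<in> M" "e \<subseteq> {1..n}" "e = {a, b, c}" "a * b = c * c"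
    unfolding triple_obstructions_def by blast
  have pos: "a > 0" "b > 0" "c > 0" using e by auto
  obtain k p q where *: "a = k * p * p" "b = k * q * q" "c = k * p * q"
    using prod_eq_square[OF e(5) pos(1)] by metis
  have pos': "k > 0" "p > 0" "q > 0" using * pos by auto
  have small: "y \<le> s" if "k * y * y \<le> n" for y
  proof (rule ccontr)
    assume "\<not> y \<le> s"
    then have "(s + 1) * (s + 1) \<le> y * y" by (intro mult_le_mono) auto
    also have "\<dots> \<le> k * (y * y)" using pos' by simp
    finally show False using that s by (simp add: power2_eq_square mult.assoc)
  qed
  have "p \<le> s" "q \<le> s" using small e * by auto
  consider "x = a" | "x = b" | "x = c" using e by auto
  then show "e \<in> ?f ` (factor_pairs M \<times> {1..s}) \<union> ?g ` (factor_pairs M \<times> {1..s})"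
  proof cases
    case 1
    have "e = ?f ((k * p, p), q)" using e(4) * pos' by (simp add: mult_ac insert_commute)
    moreover have "((k * p, p), q) \<in> factor_pairs M \<times> {1..s}"
      using 1 e(2) * pos' \<open>q \<le> s\<close> by (simp add: factor_pairs_def mult_ac)
    ultimately show ?thesis by blast
  next
    case 2
    have "e = ?f ((k * q, q), p)" using e(4) * pos' by (simp add: mult_ac insert_commute)
    moreover have "((k * q, q), p) \<in> factor_pairs M \<times> {1..s}"
      using 2 e(2) * pos' \<open>p \<le> s\<close> by (simp add: factor_pairs_def mult_ac)
    ultimately show ?thesis by blast
  next
    case 3
    have "e = ?g ((k * p, q), p)" using e(4) * pos' by (simp add: mult_ac insert_commute)
    moreover have "((k * p, q), p) \<in> factor_pairs M \<times> {1..s}"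
      using 3 e(2) * pos' \<open>p \<le> s\<close> by (simp add: factor_pairs_def mult_ac)
    ultimately show ?thesis by blast
  qed
qed

text \<open>With \<open>\<beta> = L / 2\<close> a quadruple weighs \<open>8 / L ^ 3\<close> and a
  triple \<open>4 / L ^ 2\<close>. The two maps that parametrise triples double the latter weight,
  which gives the second 8.\<close>

lemma sum_weights_le:
  fixes L :: nat
  assumes "u + L \<le> n" "n < (s + 1) ^ 2" "L > 0"
  shows "(\<Sum>e | e \<in> quad_obstructions n \<union> triple_obstructions n \<and> e \<inter> {u+1..u+L} \<noteq> {}.
      1 / (real L / 2) ^ (card e - 1)) \<le>
    2 * (L * harm s + s) * (8 * real n * harm n / real L ^ 3 + 8 * real s / real L ^ 2)"
proof -
  define M where "M = {u+1..u+L}"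
  define P where "P = factor_pairs M"
  define D where "D = {(x, y). 1 \<le> x \<and> 1 \<le> y \<and> x * y \<le> n}"
  define Q where "Q = {e \<in> quad_obstructions n. e \<inter> M \<noteq> {}}"
  define T where "T = {e \<in> triple_obstructions n. e \<inter> M \<noteq> {}}"
  have P: "finite P" "card P \<le> 2 * (L * harm s + s)"
    using card_factor_pairs[OF assms(1,2)] unfolding P_def M_def by auto
  have D: "finite D" "card D \<le> n * (harm n :: real)"
    using card_pairs_prod_le[of n] unfolding D_def by auto
  have Q: "finite Q" "card Q \<le> card P * card D"
    using quad_obstructions_meeting[of n M] P(1) D(1) finite_surj[of "P \<times> D" Q] surj_card_le[of "P \<times> D" Q]
    unfolding Q_def P_def D_def by (auto simp: card_cartesian_product)
  obtain f g where fg: "T \<subseteq> f ` (P \<times> {1..s}) \<union> g ` (P \<times> {1..s})"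
    using triple_obstructions_meeting[OF assms(2), of M] unfolding T_def P_def by blast
  have finT: "finite T" using finite_subset[OF fg] P(1) by blast
  have "card T \<le> card (f ` (P \<times> {1..s}) \<union> g ` (P \<times> {1..s}))"
    using fg P(1) by (intro card_mono) auto
  also have "\<dots> \<le> card (f ` (P \<times> {1..s})) + card (g ` (P \<times> {1..s}))" by (rule card_Un_le)
  also have "\<dots> \<le> card (P \<times> {1..s}) + card (P \<times> {1..s})"
    using P(1) by (intro add_mono card_image_le) auto
  finally have T: "card T \<le> 2 * (card P * s)" by (simp add: card_cartesian_product)
  have cards: "\<And>e. e \<in> Q \<Longrightarrow> card e = 4" "\<And>e. e \<in> T \<Longrightarrow> card e = 3"
    unfolding Q_def T_def quad_obstructions_def triple_obstructions_def by blast+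
  then have disj: "Q \<inter> T = {}" by fastforce
  have "{e. e \<in> quad_obstructions n \<union> triple_obstructions n \<and> e \<inter> M \<noteq> {}} = Q \<union> T"
    unfolding Q_def T_def by auto
  then have "(\<Sum>e | e \<in> quad_obstructions n \<union> triple_obstructions n \<and> e \<inter> M \<noteq> {}.
      1 / (real L / 2) ^ (card e - 1)) = (\<Sum>e\<in>Q \<union> T. 1 / (real L / 2) ^ (card e - 1))"
    by simp
  also have "\<dots> = (\<Sum>e\<in>Q. 1 / (real L / 2) ^ (card e - 1)) + (\<Sum>e\<in>T. 1 / (real L / 2) ^ (card e - 1))"
    using Q(1) finT disj by (rule sum.union_disjoint)
  also have "(\<Sum>e\<in>Q. 1 / (real L / 2) ^ (card e - 1)) = (\<Sum>e\<in>Q. 8 / real L ^ 3)"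
    by (intro sum.cong) (auto simp: cards power_divide)
  also have "(\<Sum>e\<in>T. 1 / (real L / 2) ^ (card e - 1)) = (\<Sum>e\<in>T. 4 / real L ^ 2)"
    by (intro sum.cong) (auto simp: cards power_divide)
  also have "(\<Sum>e\<in>Q. 8 / real L ^ 3) + (\<Sum>e\<in>T. 4 / real L ^ 2) =
      card Q * (8 / real L ^ 3) + card T * (4 / real L ^ 2)" by simp
  also have "\<dots> \<le> real (card P * card D) * (8 / real L ^ 3) + real (2 * (card P * s)) * (4 / real L ^ 2)"
    using Q(2) T by (intro add_mono mult_right_mono of_nat_mono) auto
  also have "\<dots> = card P * (card D * (8 / real L ^ 3) + 8 * real s / real L ^ 2)"
    by (simp add: algebra_simps)
  also have "\<dots> \<le> (2 * (L * harm s + s)) * (n * harm n * (8 / real L ^ 3) + 8 * real s / real L ^ 2)"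
    using P(2) D(2) by (intro mult_mono add_mono mult_right_mono) (auto intro: harm_nonneg)
  finally show ?thesis unfolding M_def by (simp add: mult_ac)
qed

section \<open>From transversals of blocks to the gap bound\<close>

lemma sidon_gap_bounds_bdd_below: "bdd_below (sidon_gap_bounds n)"
  unfolding sidon_gap_bounds_def by (intro bdd_belowI[of _ 0]) auto

text \<open>No interval of length \<open>n\<close> fits into \<open>[1, n]\<close>, so the empty set
  qualifies. This trivial bound serves for the finitely many \<open>n\<close> below the asymptotic
  threshold.\<close>

lemma sidon_gap_le_self: "sidon_gap n \<le> n"
proof -
  have "\<not> {x..x + real n} \<subseteq> {1..real n}" for x :: real
  proof
    assume "{x..x + real n} \<subseteq> {1..real n}"
    moreover have "x \<in> {x..x + real n}" "x + real n \<in> {x..x + real n}" by auto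
    ultimately have "x \<in> {1..real n}" "x + real n \<in> {1..real n}" by blast+
    then show False by auto
  qed
  then have "real n \<in> sidon_gap_bounds n"
    unfolding sidon_gap_bounds_def mult_sidon_def by (auto intro!: exI[of _ "{}"])
  then show ?thesis unfolding sidon_gap_def by (intro cInf_lower sidon_gap_bounds_bdd_below)
qed

lemma sidon_gap_le:
  fixes n L s :: nat
  assumes L: "L > 0" and s: "n < (s + 1) ^ 2"
    and weight: "2 * (L * harm s + s) * (8 * real n * harm n / real L ^ 3 + 8 * real s / real L ^ 2) \<le> real L / 2"
  shows "sidon_gap n \<le> 2 * L"
proof -
  define I where "I j = {j * L + 1..j * L + L}" for j
  \<comment> \<open>Only complete blocks are used; the remaining tail of fewer than \<open>L\<close>
    numbers gets no chosen element.\<close>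
  define J where "J = {..<n div L}"
  let ?B = "quad_obstructions n \<union> triple_obstructions n"
  have In: "j * L + L \<le> n" if "j \<in> J" for j
  proof -
    have "Suc j \<le> n div L" using that unfolding J_def by auto
    then have "Suc j * L \<le> n" using L by (simp add: less_eq_div_iff_mult_less_eq)
    then show ?thesis by simp
  qed
  have disj: "disjoint_family_on I J"
    unfolding disjoint_family_on_def
  proof (intro ballI impI)
    have apart: "I i \<inter> I j = {}" if "i < j" for i j :: nat
    proof -
      have "Suc i * L \<le> j * L" using that by (intro mult_le_mono1) auto
      then show ?thesis unfolding I_def by auto
    qed
    fix i j :: nat assume "i \<noteq> j"
    then show "I i \<inter> I j = {}" using apart[of i j] apart[of j i] by (cases "i < j") auto
  qed
  have "?B \<subseteq> Pow {1..n}" unfolding quad_obstructions_def triple_obstructions_def by blast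
  then have finB: "finite ?B" by (rule finite_subset) simp
  have "card e > 0" if "e \<in> ?B" for e
    using that unfolding quad_obstructions_def triple_obstructions_def by fastforce
  then have finB': "finite e" "e \<noteq> {}" if "e \<in> ?B" for e
    using that by (auto simp: card_gt_0_iff)
  have "\<exists>f\<in>PiE J I. \<forall>e\<in>?B. \<not> e \<subseteq> f ` J"
  \<comment> \<open>For \<open>\<beta> = L / 2\<close> the allowance
    \<open>card (I i) - \<beta>\<close> is again \<open>L / 2\<close>, the right-hand side of
    \<open>weight\<close>.\<close>
  proof (rule exists_transversal_avoiding[where \<beta> = "real L / 2"])
    fix i assume "i \<in> J"
    then have "(\<Sum>e | e \<in> ?B \<and> e \<inter> I i \<noteq> {}. 1 / (real L / 2) ^ (card e - 1)) \<le> real L / 2"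
      unfolding I_def by (intro order_trans[OF sum_weights_le[OF In s L] weight])
    then show "(\<Sum>e | e \<in> ?B \<and> e \<inter> I i \<noteq> {}. 1 / (real L / 2) ^ (card e - 1)) \<le> card (I i) - real L / 2"
      unfolding I_def by simp
  qed (use L disj finB finB' in \<open>auto simp: J_def I_def\<close>)
  then obtain f where f: "f \<in> PiE J I" "\<And>e. e \<in> ?B \<Longrightarrow> \<not> e \<subseteq> f ` J" by blast
  have fI: "j * L + 1 \<le> f j" "f j \<le> j * L + L" if "j \<in> J" for j
    using PiE_mem[OF f(1) that] unfolding I_def by auto
  have sub: "f ` J \<subseteq> {1..n}" using fI In by fastforce
  have "real (2 * L) \<in> sidon_gap_bounds n"
    unfolding sidon_gap_bounds_def
  proof (intro CollectI conjI exI allI impI)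
    show "f ` J \<subseteq> {1..n}" by fact
    show "mult_sidon (f ` J)" using mult_sidonI[OF sub] f(2) by blast
    show "0 \<le> real (2 * L)" by simp
    fix x :: real assume x: "{x..x + real (2 * L)} \<subseteq> {1..real n}"
    have "x \<in> {x..x + real (2 * L)}" "x + 2 * L \<in> {x..x + real (2 * L)}" by auto
    then have x1: "1 \<le> x" "x + 2 * L \<le> n" using x by auto
    \<comment> \<open>Block \<open>j\<close> is the first one starting at or after \<open>x\<close>.
      It starts before \<open>x + L\<close>, hence ends before \<open>x + 2 * L\<close>, which is at
      most \<open>n\<close>; so it is a complete block inside the interval.\<close>
    define j where "j = nat \<lceil>(x - 1) / L\<rceil>"
    have "0 \<le> (x - 1) / L" using x1 by simp
    then have "(x - 1) / L \<le> j" "j < (x - 1) / L + 1"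
      unfolding j_def by linarith+
    then have j: "x - 1 \<le> real (j * L)" "real (j * L) < x - 1 + L"
      using L by (auto simp: field_simps)
    then have "real (j * L + L) \<le> n" using x1 by simp
    then have "Suc j * L \<le> n" unfolding of_nat_le_iff by simp
    then have "Suc j \<le> n div L" using L by (subst less_eq_div_iff_mult_less_eq)
    then have jJ: "j \<in> J" unfolding J_def by simp
    have "real (j * L + 1) \<le> f j" "f j \<le> real (j * L + L)"
      using fI[OF jJ] by (simp_all only: of_nat_le_iff)
    then have "real (f j) \<in> {x..x + real (2 * L)}" using j by simp
    then show "real ` (f ` J) \<inter> {x..x + real (2 * L)} \<noteq> {}" using jJ by blast
  qed
  then show ?thesis
    unfolding sidon_gap_def using cInf_lower[OF _ sidon_gap_bounds_bdd_below] by fastforce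
qed

section \<open>Asymptotics and the final constant\<close>

lemma harm_le_ln:
  assumes "n \<ge> 1"
  shows "harm n \<le> 1 + ln (real n)"
  using euler_mascheroni_sequence_decreasing[of 1 n] assms by (simp add: harm_def)

lemma eventually_sidon_gap_le: "eventually (\<lambda>n. sidon_gap n \<le> 4 * real n powr (2/5)) at_top"
proof -
  \<comment> \<open>Up to logarithms the first factor has order \<open>n powr (1/2)\<close> and the
    second \<open>n powr (-1/5)\<close>, so the product is of order \<open>n powr (3/10)\<close>,
    below \<open>n powr (2/5)\<close>. The rounded length satisfies
    \<open>y \<le> L \<le> 2 * y\<close>: the upper bound is used in the first factor, the lower one
    in the denominators.\<close>
  have "eventually (\<lambda>n::nat. 2 * (2 * real n powr (2/5) * (1 + ln n) + sqrt n) *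
      (8 * n * (1 + ln n) / (real n powr (2/5)) ^ 3 + 8 * sqrt n / (real n powr (2/5)) ^ 2)
      \<le> real n powr (2/5) / 2) at_top"
    by real_asymp
  then show ?thesis
    using eventually_ge_at_top[of 1]
  proof eventually_elim
    case (elim n)
    define y where "y = real n powr (2/5)"
    define L where "L = nat \<lceil>y\<rceil>"
    define s where "s = nat \<lfloor>sqrt n\<rfloor>"
    have y: "y \<ge> 1" unfolding y_def using elim(2) by (intro ge_one_powr_ge_zero) auto
    then have L: "y \<le> L" "L \<le> 2 * y" "L > 0" unfolding L_def by linarith+
    have s: "s \<le> sqrt n" "sqrt n < s + 1" unfolding s_def by (simp_all, linarith)
    have "real n = sqrt n ^ 2" by simp
    also have "\<dots> < (real s + 1) ^ 2" using s(2) by (intro power_strict_mono) auto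
    also have "\<dots> = real ((s + 1) ^ 2)" by simp
    finally have ns: "n < (s + 1) ^ 2" by (simp only: of_nat_less_iff)
    have "s ^ 2 \<le> n"
    proof -
      have "real s ^ 2 \<le> sqrt n ^ 2" using s(1) by (intro power_mono) auto
      then show ?thesis by (simp flip: of_nat_power)
    qed
    then have "s \<le> n" using power2_nat_le_imp_le by blast
    then have hs: "harm s \<le> (harm n :: real)" by (intro harm_mono)
    have hn: "harm n \<le> 1 + ln (real n)" by (rule harm_le_ln[OF elim(2)])
    have "2 * (L * harm s + s) * (8 * real n * harm n / real L ^ 3 + 8 * real s / real L ^ 2) \<le>
        2 * (2 * y * (1 + ln n) + sqrt n) * (8 * n * (1 + ln n) / y ^ 3 + 8 * sqrt n / y ^ 2)"
      using hs hn L s y elim(2)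
      by (intro mult_mono add_mono frac_le power_mono)
        (auto intro!: harm_nonneg add_nonneg_nonneg mult_nonneg_nonneg divide_nonneg_nonneg)
    also have "\<dots> \<le> y / 2" using elim(1) unfolding y_def .
    also have "\<dots> \<le> real L / 2" using L by simp
    finally have "sidon_gap n \<le> 2 * L" using L(3) ns by (intro sidon_gap_le)
    also have "\<dots> \<le> 4 * y" using L by simp
    finally show ?case unfolding y_def .
  qed
qed

theorem theorem1p4:
  shows "\<forall>\<epsilon>::real. \<epsilon> > 0 \<longrightarrow>
           (\<exists>C::real. C > 0 \<and>
              (\<forall>n::nat. n \<ge> 1 \<longrightarrow> sidon_gap n \<le> C * real n powr (sidon_rho + \<epsilon>)))"
proof (intro allI impI)
  fix \<epsilon> :: real assume "\<epsilon> > 0"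
  \<comment> \<open>This gives \<open>sidon_rho\<close> at least
    \<open>(13 - 9) / 10 = 2/5\<close>.\<close>
  have "sqrt 69 \<le> 9" by (rule real_le_lsqrt) auto
  then have rho: "2 / 5 \<le> sidon_rho + \<epsilon>" using \<open>\<epsilon> > 0\<close> unfolding sidon_rho_def by (simp add: field_simps)
  obtain N where N: "\<And>n. n \<ge> N \<Longrightarrow> sidon_gap n \<le> 4 * real n powr (2/5)"
    using eventually_sidon_gap_le unfolding eventually_at_top_linorder by blast
  \<comment> \<open>The summand 4 serves \<open>n \<ge> N\<close>; for smaller \<open>n\<close> the
    trivial bound \<open>n < N\<close> suffices, because the power of \<open>n\<close> is at least
    1.\<close>
  have "sidon_gap n \<le> (4 + real N) * real n powr (sidon_rho + \<epsilon>)" if "n \<ge> 1" for n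
  proof (cases "n \<ge> N")
    case True
    have "sidon_gap n \<le> 4 * real n powr (2/5)" by (rule N[OF True])
    also have "\<dots> \<le> (4 + real N) * real n powr (sidon_rho + \<epsilon>)"
      using that rho by (intro mult_mono powr_mono) auto
    finally show ?thesis .
  next
    case False
    have "sidon_gap n \<le> n" by (rule sidon_gap_le_self)
    also have "\<dots> \<le> (4 + real N) * 1" using False by simp
    also have "\<dots> \<le> (4 + real N) * real n powr (sidon_rho + \<epsilon>)"
      using that rho by (intro mult_left_mono ge_one_powr_ge_zero) auto
    finally show ?thesis .
  qed
  then show "\<exists>C>0. \<forall>n\<ge>1. sidon_gap n \<le> C * real n powr (sidon_rho + \<epsilon>)"
    by (intro exI[of _ "4 + real N"]) auto
qed

end
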